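(* Let $X,Y$ be indeterminates, $b_k=2k+X+Y$ for $k\ge0$ and $\lambda_k=(k+X)(k-1+Y)$ for $k\ge1$. Then for every $n\ge0$, \[ \mu_n(b_k,\lambda_k)=\sum_{\pi\in\mathfrak S_n}(X+1)^{\mathrm{RLmin}(\pi)-\mathrm{pivot}(\pi)}(X+Y)^{\mathrm{pivot}(\pi)}Y^{\mathrm{LRmax}(\pi)-\mathrm{pivot}(\pi)} . \]
   Context: For sequences $(b_k)_{k\ge0}$, $(\lambda_k)_{k\ge1}$ let $p_n$ be the monic polynomials with $p_{-1}=0$, $p_0=1$, $p_{n+1}=(x-b_n)p_n-\lambda_np_{n-1}$; $\mu_n(b_k,\lambda_k)$ denotes $\mathcal L(x^n)$, where $\mathcal L$ is the unique linear functional on polynomials with $\mathcal L(1)=1$ and $\mathcal L(p_m)=0$ for all $m\ge1$. $\mathfrak S_n$ is the set of permutations $\pi=\pi_1\cdots\pi_n$ of $\{1,\dots,n\}$. $\pi_i$ is a right-to-left minimum if $\pi_i<\pi_j$ for all $j>i$, and a left-to-right maximum if $\pi_i>\pi_j$ for all $j<i$; $\mathrm{RLmin}(\pi)$, $\mathrm{LRmax}(\pi)$ are their numbers. A pivot is an entry that is both a left-to-right maximum and a right-to-left minimum; $\mathrm{pivot}(\pi)$ is their number. *)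

theory Defs
  imports
    "HOL-Computational_Algebra.Polynomial"
    "HOL-Combinatorics.Permutations"
begin

fun orth_poly :: "(nat \<Rightarrow> 'r::comm_ring_1) \<Rightarrow> (nat \<Rightarrow> 'r) \<Rightarrow> nat \<Rightarrow> 'r poly" where
  "orth_poly b l 0 = 1"
| "orth_poly b l (Suc 0) = [:- b 0, 1:]"
| "orth_poly b l (Suc (Suc n)) =
     [:- b (Suc n), 1:] * orth_poly b l (Suc n) - smult (l (Suc n)) (orth_poly b l n)"

text \<open>The second equation is the recurrence at index 0 with the convention that the polynomial of
  index -1 vanishes, so the value of \<open>l\<close> at 0 is never used.\<close>

definition is_moment_functional ::
    "(nat \<Rightarrow> 'r::comm_ring_1) \<Rightarrow> (nat \<Rightarrow> 'r) \<Rightarrow> ('r poly \<Rightarrow> 'r) \<Rightarrow> bool" where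
  "is_moment_functional b l L \<longleftrightarrow>
     module_hom smult (*) L \<and> L 1 = 1 \<and> (\<forall>m\<ge>1. L (orth_poly b l m) = 0)"

definition moment_functional ::
    "(nat \<Rightarrow> 'r::comm_ring_1) \<Rightarrow> (nat \<Rightarrow> 'r) \<Rightarrow> 'r poly \<Rightarrow> 'r" where
  "moment_functional b l = (THE L. is_moment_functional b l L)"

definition moment :: "(nat \<Rightarrow> 'r::comm_ring_1) \<Rightarrow> (nat \<Rightarrow> 'r) \<Rightarrow> nat \<Rightarrow> 'r" where
  "moment b l n = moment_functional b l (monom 1 n)"

lemma coeff_orth_poly:
  "coeff (orth_poly b l n) n = 1 \<and> (\<forall>i>n. coeff (orth_poly b l n) i = 0)"
proof (induction b l n rule: orth_poly.induct)
  case (2 b l)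
  then show ?case by (auto simp: coeff_pCons split: nat.splits)
next
  case (3 b l n)
  then show ?case by (auto simp: coeff_pCons split: nat.splits)
qed simp

lemma degree_orth_poly_le: "degree (orth_poly b l n) \<le> n"
  using coeff_orth_poly by (metis degree_le)

lemma orth_poly_expand:
  "orth_poly b l n = monom 1 n + (\<Sum>i<n. smult (coeff (orth_poly b l n) i) (monom 1 i))"
proof -
  have "orth_poly b l n = (\<Sum>i\<le>n. monom (coeff (orth_poly b l n) i) i)"
    using poly_as_sum_of_monoms'[OF degree_orth_poly_le] by metis
  then show ?thesis
    by (simp add: lessThan_Suc_atMost[symmetric] coeff_orth_poly smult_monom add.commute)
qed

fun moment_aux :: "(nat \<Rightarrow> 'r::comm_ring_1) \<Rightarrow> (nat \<Rightarrow> 'r) \<Rightarrow> nat \<Rightarrow> 'r" where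
  "moment_aux b l n =
     (if n = 0 then 1 else - (\<Sum>i<n. coeff (orth_poly b l n) i * moment_aux b l i))"

declare moment_aux.simps [simp del]

lemma ex_moment_functional: "\<exists>L. is_moment_functional b l L"
proof -
  define L where "L q = (\<Sum>i\<le>degree q. coeff q i * moment_aux b l i)" for q
  have L: "L q = (\<Sum>i\<le>N. coeff q i * moment_aux b l i)" if "degree q \<le> N" for q N
    unfolding L_def using that
    by (intro sum.mono_neutral_left) (auto simp: coeff_eq_0 not_le)
  have add: "L (p + q) = L p + L q" for p q
  proof -
    let ?N = "max (degree p) (degree q)"
    have "L (p + q) = (\<Sum>i\<le>?N. coeff (p + q) i * moment_aux b l i)"
      by (rule L) (rule degree_add_le_max)
    also have "\<dots> = L p + L q"
      by (simp add: L[of p ?N] L[of q ?N] sum.distrib algebra_simps)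
    finally show ?thesis .
  qed
  have scale: "L (smult c p) = c * L p" for c p
    by (subst L[of "smult c p" "degree p"])
       (auto simp: L_def sum_distrib_left mult.assoc degree_smult_le)
  have "module_hom smult (*) L"
    by unfold_locales (auto simp: add scale smult_add_right smult_add_left algebra_simps)
  moreover have "L 1 = 1"
    by (simp add: L_def moment_aux.simps)
  moreover have "L (orth_poly b l m) = 0" if "m \<ge> 1" for m
    using that
    by (subst L[OF degree_orth_poly_le])
       (simp add: lessThan_Suc_atMost[symmetric] coeff_orth_poly moment_aux.simps[of b l m])
  ultimately show ?thesis
    unfolding is_moment_functional_def by blast
qed

lemma moment_functional_monom:
  assumes "is_moment_functional b l L"
  shows "L (monom 1 n) = moment_aux b l n"
proof (induction n rule: less_induct)
  case (less n)
  interpret module_hom smult "(*)" L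
    using assms by (simp add: is_moment_functional_def)
  show ?case
  proof (cases "n = 0")
    case True
    then show ?thesis
      using assms by (simp add: is_moment_functional_def moment_aux.simps one_poly_eq_simps
        monom_0 flip: one_pCons)
  next
    case False
    have "0 = L (orth_poly b l n)"
      using assms False by (simp add: is_moment_functional_def)
    also have "\<dots> = L (monom 1 n) + (\<Sum>i<n. coeff (orth_poly b l n) i * L (monom 1 i))"
      by (subst orth_poly_expand) (simp only: add sum scale)
    also have "\<dots> = L (monom 1 n) - moment_aux b l n"
      using False less by (simp add: moment_aux.simps[of b l n])
    finally show ?thesis by simp
  qed
qed

lemma ex1_moment_functional: "\<exists>!L. is_moment_functional b l L"
proof (rule ex_ex1I[OF ex_moment_functional])
  fix L L' assume *: "is_moment_functional b l L" "is_moment_functional b l L'"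
  have eq: "K q = (\<Sum>i\<le>degree q. coeff q i * moment_aux b l i)"
    if "is_moment_functional b l K" for K q
  proof -
    interpret module_hom smult "(*)" K
      using that by (simp add: is_moment_functional_def)
    have "K q = K (\<Sum>i\<le>degree q. smult (coeff q i) (monom 1 i))"
      by (simp add: smult_monom poly_as_sum_of_monoms)
    also have "\<dots> = (\<Sum>i\<le>degree q. coeff q i * moment_aux b l i)"
      by (simp only: sum scale moment_functional_monom[OF that])
    finally show ?thesis .
  qed
  show "L = L'"
    using eq[OF *(1)] eq[OF *(2)] by (intro ext) simp
qed

lemma is_moment_functional_moment_functional:
  "is_moment_functional b l (moment_functional b l)"
  unfolding moment_functional_def by (rule theI'[OF ex1_moment_functional])

text \<open>Entries of a permutation \<open>\<pi>\<close> of \<open>{1..n}\<close> are counted by their positions.\<close>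

definition is_RLmin :: "nat \<Rightarrow> (nat \<Rightarrow> nat) \<Rightarrow> nat \<Rightarrow> bool" where
  "is_RLmin n \<pi> i \<longleftrightarrow> (\<forall>j\<in>{1..n}. j > i \<longrightarrow> \<pi> i < \<pi> j)"

definition is_LRmax :: "nat \<Rightarrow> (nat \<Rightarrow> nat) \<Rightarrow> nat \<Rightarrow> bool" where
  "is_LRmax n \<pi> i \<longleftrightarrow> (\<forall>j\<in>{1..n}. j < i \<longrightarrow> \<pi> i > \<pi> j)"

definition RLmin :: "nat \<Rightarrow> (nat \<Rightarrow> nat) \<Rightarrow> nat" where
  "RLmin n \<pi> = card {i \<in> {1..n}. is_RLmin n \<pi> i}"

definition LRmax :: "nat \<Rightarrow> (nat \<Rightarrow> nat) \<Rightarrow> nat" where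
  "LRmax n \<pi> = card {i \<in> {1..n}. is_LRmax n \<pi> i}"

definition pivot :: "nat \<Rightarrow> (nat \<Rightarrow> nat) \<Rightarrow> nat" where
  "pivot n \<pi> = card {i \<in> {1..n}. is_LRmax n \<pi> i \<and> is_RLmin n \<pi> i}"

lemma pivot_le_RLmin: "pivot n \<pi> \<le> RLmin n \<pi>"
  and pivot_le_LRmax: "pivot n \<pi> \<le> LRmax n \<pi>"
  unfolding pivot_def RLmin_def LRmax_def by (auto intro!: card_mono)

end

theory Submission
  imports Defs
begin

text \<open>
  Scan the positions and the values \<open>1, \<dots>, n\<close> of a permutation simultaneously, as in the bijection of
  Foata and Zeilberger. After step \<open>m\<close> one sees a placement \<open>R\<close> of non-attacking rooks on the
  \<open>m \<times> m\<close> board, with \<open>k = m - card R\<close> free rows and as many free columns. A rook \<open>(i, v)\<close> with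
  \<open>i < v\<close> is a left-to-right maximum iff row \<open>i\<close> is the first free row when column \<open>v\<close> is added;
  a rook with \<open>v < i\<close> is a right-to-left minimum iff column \<open>v\<close> is the first free column when row
  \<open>i\<close> is added; a diagonal rook is a pivot iff nothing is free. Hence, with weights \<open>a\<close>, \<open>p\<close>, \<open>c\<close> for
  exclusive right-to-left minima, pivots and exclusive left-to-right maxima, the extensions of \<open>R\<close>
  to the next board carry total weight 1 (\<open>k\<close> grows), \<open>p\<close> if \<open>k = 0\<close> and
  \<open>1 + (a + k - 1) + (c + k - 1)\<close> otherwise (\<open>k\<close> stays), and \<open>(a + k - 1) (c + k - 1)\<close> (\<open>k\<close> drops).
  For \<open>a = X + 1\<close>, \<open>p = X + Y\<close>, \<open>c = Y\<close> this is the three-term recurrence, so that \<open>x\<^sup>m\<close> is the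
  weighted sum of the orthogonal polynomials of index \<open>m - card R\<close>; the moment functional leaves
  only the full placements.
\<close>

section \<open>Rook placements on the square board, their free rows and columns, and their
  weights\<close>

definition rook_placements :: "nat \<Rightarrow> (nat \<times> nat) set set" where
  "rook_placements m = {R. R \<subseteq> {1..m} \<times> {1..m} \<and> inj_on fst R \<and> inj_on snd R}"

definition free_rows :: "nat \<Rightarrow> (nat \<times> nat) set \<Rightarrow> nat set" where
  "free_rows m R = {1..m} - fst ` R"

definition free_cols :: "nat \<Rightarrow> (nat \<times> nat) set \<Rightarrow> nat set" where
  "free_cols m R = {1..m} - snd ` R"

text \<open>The condition on a cell only involves the board on which both its row and its column have just
  appeared, so the weight of a rook does not change when the placement is extended.\<close>

definition cell_weight :: "'r::comm_ring_1 \<Rightarrow> 'r \<Rightarrow> 'r \<Rightarrow> (nat \<times> nat) set \<Rightarrow> nat \<times> nat \<Rightarrow> 'r" where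
  "cell_weight a p c R = (\<lambda>(i, v).
     if i < v then if \<forall>j\<in>{1..<i}. \<exists>u<v. (j, u) \<in> R then c else 1
     else if v < i then if \<forall>u\<in>{1..<v}. \<exists>j<i. (j, u) \<in> R then a else 1
     else if \<forall>j\<in>{1..<i}. \<exists>u<v. (j, u) \<in> R then p else 1)"

definition placement_weight :: "'r::comm_ring_1 \<Rightarrow> 'r \<Rightarrow> 'r \<Rightarrow> (nat \<times> nat) set \<Rightarrow> 'r" where
  "placement_weight a p c R = prod (cell_weight a p c R) R"

lemma rook_placements_0: "rook_placements 0 = {{}}"
  by (auto simp: rook_placements_def)

lemma finite_rook_placements: "finite (rook_placements m)"
  by (rule finite_subset[of _ "Pow ({1..m} \<times> {1..m})"]) (auto simp: rook_placements_def)

lemma rook_placement_finite: "R \<in> rook_placements m \<Longrightarrow> finite R"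
  unfolding rook_placements_def by (metis (lifting) mem_Collect_eq finite_SigmaI finite_atLeastAtMost finite_subset)

lemma card_free_rows:
  assumes "R \<in> rook_placements m"
  shows "card (free_rows m R) = m - card R"
proof -
  have "fst ` R \<subseteq> {1..m}" "inj_on fst R"
    using assms by (auto simp: rook_placements_def)
  then show ?thesis
    unfolding free_rows_def by (simp add: card_Diff_subset card_image finite_subset)
qed

lemma card_free_cols:
  assumes "R \<in> rook_placements m"
  shows "card (free_cols m R) = m - card R"
proof -
  have "snd ` R \<subseteq> {1..m}" "inj_on snd R"
    using assms by (auto simp: rook_placements_def)
  then show ?thesis
    unfolding free_cols_def by (simp add: card_Diff_subset card_image finite_subset)
qed

lemma card_rook_placement_le:
  assumes "R \<in> rook_placements m"
  shows "card R \<le> m"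
proof -
  have "card R = card (fst ` R)" "fst ` R \<subseteq> {1..m}"
    using assms by (auto simp: rook_placements_def card_image)
  then show ?thesis
    by (metis card_mono finite_atLeastAtMost card_atLeastAtMost diff_Suc_1)
qed

lemma free_rows_ge: "i \<in> free_rows m R \<Longrightarrow> 1 \<le> i"
  by (simp add: free_rows_def)

lemma free_cols_ge: "v \<in> free_cols m R \<Longrightarrow> 1 \<le> v"
  by (simp add: free_cols_def)

section \<open>Weights of the rooks added with a new row and column\<close>

text \<open>Exactly one element of \<open>S\<close>, its minimum, contributes \<open>c\<close>; the
  others contribute 1 each. Over free rows or columns this yields the factors
  \<open>c + k - 1\<close> and \<open>a + k - 1\<close>.\<close>

lemma sum_least_weight:
  fixes S :: "nat set" and c :: "'r::comm_ring_1"
  assumes "finite S" "S \<noteq> {}"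
  shows "(\<Sum>i\<in>S. if \<forall>j\<in>S. i \<le> j then c else 1) = c + of_nat (card S) - 1"
proof -
  have eq: "(\<forall>j\<in>S. i \<le> j) \<longleftrightarrow> i = Min S" if "i \<in> S" for i
    using assms that by (metis Min_eqI Min_le)
  have "(\<Sum>i\<in>S. if \<forall>j\<in>S. i \<le> j then c else 1) = (\<Sum>i\<in>S. if i = Min S then c else 1)"
    by (rule sum.cong) (auto simp: eq)
  also have "\<dots> = c + (\<Sum>i\<in>S - {Min S}. if i = Min S then c else 1)"
    using assms by (subst sum.remove[of S "Min S"]) auto
  also have "(\<Sum>i\<in>S - {Min S}. if i = Min S then c else 1) = (\<Sum>i\<in>S - {Min S}. 1)"
    by (rule sum.cong) auto
  also have "\<dots> = of_nat (card S) - 1"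
    using assms by (simp add: card_Diff_singleton of_nat_diff Suc_leI card_gt_0_iff)
  finally show ?thesis by simp
qed

text \<open>The condition at a rook of \<open>R\<close> inspects only cells of the old board, and
  \<open>E\<close> has none there. \<open>E\<close> is a set because a rook in the new row and one
  in the new column may be added together.\<close>

lemma placement_weight_extend:
  assumes R: "R \<in> rook_placements m"
    and E: "finite E" "E \<inter> {1..m} \<times> {1..m} = {}" "E \<subseteq> {1..Suc m} \<times> {1..Suc m}"
  shows "placement_weight a p c (R \<union> E) =
    placement_weight a p c R * prod (cell_weight a p c (R \<union> E)) E"
proof -
  have sub: "R \<subseteq> {1..m} \<times> {1..m}" using R by (simp add: rook_placements_def)
  have "cell_weight a p c (R \<union> E) e = cell_weight a p c R e" if "e \<in> R" for e
  proof -
    obtain i v where e: "e = (i, v)" by (cases e)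
    have iv: "i \<le> m" "v \<le> m" using that sub e by auto
    have notE: "(j, u) \<notin> E" if "j \<le> m" "u \<le> m" for j u
      using E(2,3) that by fastforce
    have "(\<forall>j\<in>{1..<i}. \<exists>u<v. (j, u) \<in> R \<union> E) \<longleftrightarrow> (\<forall>j\<in>{1..<i}. \<exists>u<v. (j, u) \<in> R)"
      "(\<forall>u\<in>{1..<v}. \<exists>j<i. (j, u) \<in> R \<union> E) \<longleftrightarrow> (\<forall>u\<in>{1..<v}. \<exists>j<i. (j, u) \<in> R)"
      using iv by (simp_all add: notE cong: conj_cong)
    then show ?thesis
      unfolding e cell_weight_def prod.case by presburger
  qed
  then have "prod (cell_weight a p c (R \<union> E)) R = placement_weight a p c R"
    unfolding placement_weight_def by (intro prod.cong) auto
  moreover have "R \<inter> E = {}" using sub E by blast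
  ultimately show ?thesis
    unfolding placement_weight_def using rook_placement_finite[OF R] E(1)
    by (simp add: prod.union_disjoint)
qed

text \<open>Rows below \<open>i\<close> and columns below \<open>Suc m\<close> stay within the old
  board, so a simultaneous rook in the new row does not interfere: the condition says that every row
  before \<open>i\<close> is occupied by \<open>R\<close>. The next lemma is the transpose.\<close>

lemma cell_weight_last_col:
  assumes R: "R \<in> rook_placements m"
    and E: "E \<inter> {1..m} \<times> {1..m} = {}" "E \<subseteq> {1..Suc m} \<times> {1..Suc m}"
    and i: "i \<in> free_rows m R"
  shows "cell_weight a p c (R \<union> E) (i, Suc m) = (if \<forall>j\<in>free_rows m R. i \<le> j then c else 1)"
proof -
  have sub: "R \<subseteq> {1..m} \<times> {1..m}" using R by (simp add: rook_placements_def)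
  have "(\<exists>u<Suc m. (j, u) \<in> R \<union> E) \<longleftrightarrow> j \<notin> free_rows m R" if "j \<in> {1..<i}" for j
    using sub E that i unfolding free_rows_def by (force simp: image_iff)
  then have "(\<forall>j\<in>{1..<i}. \<exists>u<Suc m. (j, u) \<in> R \<union> E) \<longleftrightarrow> (\<forall>j\<in>{1..<i}. j \<notin> free_rows m R)"
    by (intro ball_cong refl)
  also have "\<dots> \<longleftrightarrow> (\<forall>j\<in>free_rows m R. i \<le> j)"
    by (metis atLeastLessThan_iff free_rows_ge not_le)
  finally have "(\<forall>j\<in>{1..<i}. \<exists>u<Suc m. (j, u) \<in> R \<union> E) \<longleftrightarrow> (\<forall>j\<in>free_rows m R. i \<le> j)" .
  then show ?thesis
    using i unfolding cell_weight_def free_rows_def by auto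
qed

lemma cell_weight_last_row:
  assumes R: "R \<in> rook_placements m"
    and E: "E \<inter> {1..m} \<times> {1..m} = {}" "E \<subseteq> {1..Suc m} \<times> {1..Suc m}"
    and v: "v \<in> free_cols m R"
  shows "cell_weight a p c (R \<union> E) (Suc m, v) = (if \<forall>u\<in>free_cols m R. v \<le> u then a else 1)"
proof -
  have sub: "R \<subseteq> {1..m} \<times> {1..m}" using R by (simp add: rook_placements_def)
  have "(\<exists>j<Suc m. (j, u) \<in> R \<union> E) \<longleftrightarrow> u \<notin> free_cols m R" if "u \<in> {1..<v}" for u
    using sub E that v unfolding free_cols_def by (force simp: image_iff)
  then have "(\<forall>u\<in>{1..<v}. \<exists>j<Suc m. (j, u) \<in> R \<union> E) \<longleftrightarrow> (\<forall>u\<in>{1..<v}. u \<notin> free_cols m R)"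
    by (intro ball_cong refl)
  also have "\<dots> \<longleftrightarrow> (\<forall>u\<in>free_cols m R. v \<le> u)"
    by (metis atLeastLessThan_iff free_cols_ge not_le)
  finally have "(\<forall>u\<in>{1..<v}. \<exists>j<Suc m. (j, u) \<in> R \<union> E) \<longleftrightarrow> (\<forall>u\<in>free_cols m R. v \<le> u)" .
  then show ?thesis
    using v unfolding cell_weight_def free_cols_def by auto
qed

text \<open>At the corner the condition ranges over all old rows, so it holds iff no row is free,
  which by counting means \<open>m\<close> rooks.\<close>

lemma cell_weight_corner:
  assumes R: "R \<in> rook_placements m"
  shows "cell_weight a p c (insert (Suc m, Suc m) R) (Suc m, Suc m) = (if card R = m then p else 1)"
proof -
  have sub: "R \<subseteq> {1..m} \<times> {1..m}" using R by (simp add: rook_placements_def)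
  have "(\<exists>u<Suc m. (j, u) \<in> insert (Suc m, Suc m) R) \<longleftrightarrow> j \<notin> free_rows m R" if "j \<in> {1..<Suc m}" for j
  proof -
    have "j \<notin> free_rows m R \<longleftrightarrow> (\<exists>u. (j, u) \<in> R)"
      using that unfolding free_rows_def by force
    moreover have "u < Suc m" if "(j, u) \<in> R" for u
      using sub that by auto
    ultimately show ?thesis using that by auto
  qed
  then have "(\<forall>j\<in>{1..<Suc m}. \<exists>u<Suc m. (j, u) \<in> insert (Suc m, Suc m) R) \<longleftrightarrow>
      (\<forall>j\<in>{1..<Suc m}. j \<notin> free_rows m R)"
    by (intro ball_cong refl)
  also have "\<dots> \<longleftrightarrow> free_rows m R = {}"
    unfolding free_rows_def by fastforce
  also have "\<dots> \<longleftrightarrow> card (free_rows m R) = 0"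
    by (simp add: free_rows_def)
  also have "\<dots> \<longleftrightarrow> card R = m"
    using card_rook_placement_le[OF R] by (auto simp: card_free_rows[OF R])
  finally show ?thesis
    unfolding cell_weight_def by simp
qed

section \<open>Extending a placement to the next board\<close>

text \<open>The new row and the new column hold at most one rook each, and a rook in the corner uses
  up both. This leaves five kinds of extension: none, corner, column only, row only, one of
  each.\<close>

lemma rook_placement_extensions:
  assumes R: "R \<in> rook_placements m"
  shows "{R' \<in> rook_placements (Suc m). R' \<inter> {1..m} \<times> {1..m} = R} =
    {R, insert (Suc m, Suc m) R} \<union>
    (\<lambda>i. insert (i, Suc m) R) ` free_rows m R \<union>
    (\<lambda>v. insert (Suc m, v) R) ` free_cols m R \<union>
    (\<lambda>(i, v). insert (i, Suc m) (insert (Suc m, v) R)) ` (free_rows m R \<times> free_cols m R)"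
    (is "?L = ?A")
proof (intro subset_antisym subsetI)
  have sub: "R \<subseteq> {1..m} \<times> {1..m}" and inj: "inj_on fst R" "inj_on snd R"
    using R by (auto simp: rook_placements_def)
  {
    fix R' assume R': "R' \<in> ?A"
    have "R' \<inter> {1..m} \<times> {1..m} = R" "R' \<subseteq> {1..Suc m} \<times> {1..Suc m}"
      using R' sub by (auto simp: free_rows_def free_cols_def)
    moreover have "inj_on fst R'" "inj_on snd R'"
    proof -
      have ins: "inj_on f (insert e S)" if "inj_on f S" "f e \<notin> f ` S"
        for f :: "nat \<times> nat \<Rightarrow> nat" and e S
        using that by auto
      have "Suc m \<notin> fst ` R" "Suc m \<notin> snd ` R" using sub by auto
      then show "inj_on fst R'" "inj_on snd R'"
        using R' inj unfolding free_rows_def free_cols_def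
        by (elim UnE imageE insertE emptyE; simp add: ins case_prod_beta mem_Times_iff del: inj_on_insert)+
    qed
    ultimately show "R' \<in> ?L" by (simp add: rook_placements_def)
  next
    fix R' assume R': "R' \<in> ?L"
    have sub': "R' \<subseteq> {1..Suc m} \<times> {1..Suc m}" and inj': "inj_on fst R'" "inj_on snd R'"
      and cap: "R' \<inter> {1..m} \<times> {1..m} = R"
      using R' by (auto simp: rook_placements_def)
    have row: "v = v'" if "(i, v) \<in> R'" "(i, v') \<in> R'" for i v v'
      using inj_onD[OF inj'(1) _ that] by simp
    have col: "i = i'" if "(i, v) \<in> R'" "(i', v) \<in> R'" for i i' v
      using inj_onD[OF inj'(2) _ that] by simp
    have R_sub: "R \<subseteq> R'" using cap by blast
    \<comment> \<open>A cell off the old board lies in the last column or the last row. Each of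
      these strips holds at most one rook, so knowing these rooks determines
      \<open>R'\<close>.\<close>
    have R'_eq: "R' = {e \<in> R'. snd e = Suc m} \<union> {e \<in> R'. fst e = Suc m} \<union> R"
      using sub' cap by (auto simp: le_Suc_eq subset_iff) metis+
    have last_col: "{e \<in> R'. snd e = Suc m} = {(i, Suc m)}" if "(i, Suc m) \<in> R'" for i
      using that col by auto
    have last_row: "{e \<in> R'. fst e = Suc m} = {(Suc m, v)}" if "(Suc m, v) \<in> R'" for v
      using that row by auto
    have fr: "i \<in> free_rows m R" if "(i, Suc m) \<in> R'" "i \<in> {1..m}" for i
      using that row R_sub sub unfolding free_rows_def by fastforce
    have fc: "v \<in> free_cols m R" if "(Suc m, v) \<in> R'" "v \<in> {1..m}" for v
      using that col R_sub sub unfolding free_cols_def by fastforce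
    consider (corner) "(Suc m, Suc m) \<in> R'"
      | (both) i v where "(i, Suc m) \<in> R'" "i \<in> {1..m}" "(Suc m, v) \<in> R'" "v \<in> {1..m}"
      | (only_col) i where "(i, Suc m) \<in> R'" "i \<in> {1..m}" "{e \<in> R'. fst e = Suc m} = {}"
      | (only_row) v where "(Suc m, v) \<in> R'" "v \<in> {1..m}" "{e \<in> R'. snd e = Suc m} = {}"
      | (none) "{e \<in> R'. fst e = Suc m} = {}" "{e \<in> R'. snd e = Suc m} = {}"
    proof -
      have c: "(\<exists>i\<in>{1..m}. (i, Suc m) \<in> R') \<or> {e \<in> R'. snd e = Suc m} = {}"
        if "(Suc m, Suc m) \<notin> R'"
        using sub' that by (force simp: le_Suc_eq)
      have r: "(\<exists>v\<in>{1..m}. (Suc m, v) \<in> R') \<or> {e \<in> R'. fst e = Suc m} = {}"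
        if "(Suc m, Suc m) \<notin> R'"
        using sub' that by (force simp: le_Suc_eq)
      show ?thesis
      proof (cases "(Suc m, Suc m) \<in> R'")
        case True
        then show ?thesis by (rule that(1))
      next
        case False
        show ?thesis using c[OF False] r[OF False] that(2-5) by blast
      qed
    qed
    then show "R' \<in> ?A"
    proof cases
      case corner
      have "R' = insert (Suc m, Suc m) R"
        using R'_eq by (simp add: last_col[OF corner] last_row[OF corner])
      then show ?thesis by simp
    next
      case (both i v)
      have "R' = insert (i, Suc m) (insert (Suc m, v) R)"
        using R'_eq by (simp add: last_col[OF both(1)] last_row[OF both(3)] insert_commute)
      moreover have "(i, v) \<in> free_rows m R \<times> free_cols m R"
        using both fr fc by simp
      ultimately show ?thesis by (intro UnI2) (rule rev_image_eqI, auto)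
    next
      case (only_col i)
      have "R' = insert (i, Suc m) R"
        using R'_eq by (simp add: last_col[OF only_col(1)] only_col(3))
      then show ?thesis using fr[OF only_col(1,2)] by blast
    next
      case (only_row v)
      have "R' = insert (Suc m, v) R"
        using R'_eq by (simp add: last_row[OF only_row(1)] only_row(3))
      then show ?thesis using fc[OF only_row(1,2)] by blast
    next
      case none
      have "R' = R"
        using R'_eq by (simp add: none)
      then show ?thesis by simp
    qed
  }
qed

lemma smult_sum_left: "smult (sum f S) q = (\<Sum>i\<in>S. smult (f i) q)"
  by (induction S rule: infinite_finite_induct) (auto simp: smult_add_left)

text \<open>The family \<open>g\<close> sees only the number of free rows, which becomes
  \<open>k + 1\<close>, \<open>k\<close> or \<open>k - 1\<close> when zero, one or two rooks are
  added. For the orthogonal polynomials the bracket becomes \<open>x\<close> times the one of index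
  \<open>k\<close>.\<close>

lemma sum_over_extensions:
  fixes g :: "nat \<Rightarrow> 'r::comm_ring_1 poly"
  assumes R: "R \<in> rook_placements m" and k: "k = m - card R"
  shows "(\<Sum>R' | R' \<in> rook_placements (Suc m) \<and> R' \<inter> {1..m} \<times> {1..m} = R.
      smult (placement_weight a p c R') (g (Suc m - card R'))) =
    smult (placement_weight a p c R)
      (g (Suc k) + smult (if k = 0 then p else a + c + 2 * of_nat k - 1) (g k) +
       (if k = 0 then 0 else smult ((a + of_nat k - 1) * (c + of_nat k - 1)) (g (k - 1))))"
proof -
  define h where "h R' = smult (placement_weight a p c R') (g (Suc m - card R'))" for R'
  define w where "w = placement_weight a p c R"
  define F where "F = free_rows m R"
  define G where "G = free_cols m R"
  define fr where "fr i = (if \<forall>j\<in>F. i \<le> j then c else 1)" for i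
  define fc where "fc v = (if \<forall>u\<in>G. v \<le> u then a else 1)" for v
  define S2 where "S2 = (\<lambda>i. insert (i, Suc m) R) ` F"
  define S3 where "S3 = (\<lambda>v. insert (Suc m, v) R) ` G"
  define S4 where "S4 = (\<lambda>(i, v). insert (i, Suc m) (insert (Suc m, v) R)) ` (F \<times> G)"
  have sub: "R \<subseteq> {1..m} \<times> {1..m}" and finR: "finite R"
    using R rook_placement_finite by (auto simp: rook_placements_def)
  have last: "(Suc m, v) \<notin> R" "(i, Suc m) \<notin> R" for i v
    using sub by auto
  have finFG: "finite F" "finite G" and FG: "F \<subseteq> {1..m}" "G \<subseteq> {1..m}"
    by (auto simp: F_def G_def free_rows_def free_cols_def)
  have cardFG: "card F = k" "card G = k"
    using R k by (auto simp: F_def G_def card_free_rows card_free_cols)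
  have le: "card R \<le> m" by (rule card_rook_placement_le[OF R])
  have notM: "Suc m \<notin> F" "Suc m \<notin> G" using FG by auto

  have h0: "h R = smult w (g (Suc k))"
    using le by (simp add: h_def w_def k Suc_diff_le)
  have h1: "h (insert (Suc m, Suc m) R) = smult (w * (if k = 0 then p else 1)) (g k)"
  proof -
    have "placement_weight a p c (R \<union> {(Suc m, Suc m)}) = w * (if card R = m then p else 1)"
      unfolding w_def by (subst placement_weight_extend[OF R]) (auto simp: cell_weight_corner[OF R])
    moreover have "card R = m \<longleftrightarrow> k = 0" using le k by auto
    ultimately show ?thesis using finR last by (simp add: h_def k)
  qed
  have h2: "h (insert (i, Suc m) R) = smult (w * fr i) (g k)" if i: "i \<in> F" for i
  proof -
    have E: "{(i, Suc m)} \<inter> {1..m} \<times> {1..m} = {}" "{(i, Suc m)} \<subseteq> {1..Suc m} \<times> {1..Suc m}"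
      using i FG by auto
    have "placement_weight a p c (R \<union> {(i, Suc m)}) = w * fr i"
      using placement_weight_extend[OF R _ E, of a p c]
        cell_weight_last_col[OF R E i[unfolded F_def], of a p c]
      by (simp add: w_def fr_def F_def)
    then show ?thesis using finR last by (simp add: h_def k)
  qed
  have h3: "h (insert (Suc m, v) R) = smult (w * fc v) (g k)" if v: "v \<in> G" for v
  proof -
    have E: "{(Suc m, v)} \<inter> {1..m} \<times> {1..m} = {}" "{(Suc m, v)} \<subseteq> {1..Suc m} \<times> {1..Suc m}"
      using v FG by auto
    have "placement_weight a p c (R \<union> {(Suc m, v)}) = w * fc v"
      using placement_weight_extend[OF R _ E, of a p c]
        cell_weight_last_row[OF R E v[unfolded G_def], of a p c]
      by (simp add: w_def fc_def G_def)
    then show ?thesis using finR last by (simp add: h_def k)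
  qed
  have h4: "h (insert (i, Suc m) (insert (Suc m, v) R)) = smult (w * (fr i * fc v)) (g (k - 1))"
    if i: "i \<in> F" and v: "v \<in> G" for i v
  proof -
    let ?E = "{(i, Suc m), (Suc m, v)}"
    have E: "?E \<inter> {1..m} \<times> {1..m} = {}" "?E \<subseteq> {1..Suc m} \<times> {1..Suc m}"
      using i v FG by auto
    have ne: "(i, Suc m) \<noteq> (Suc m, v)" using i notM by auto
    have "placement_weight a p c (R \<union> ?E) = w * (fr i * fc v)"
      using placement_weight_extend[OF R _ E, of a p c] ne
        cell_weight_last_col[OF R E i[unfolded F_def], of a p c]
        cell_weight_last_row[OF R E v[unfolded G_def], of a p c]
      by (simp add: w_def fc_def G_def fr_def F_def)
    then show ?thesis using finR last ne by (simp add: h_def k)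
  qed

  have sum2: "sum h S2 = (\<Sum>i\<in>F. smult (w * fr i) (g k))"
  proof -
    have "inj_on (\<lambda>i. insert (i, Suc m) R) F"
      using last by (intro inj_onI) (metis insertE insertI1 prod.inject)
    then show ?thesis unfolding S2_def by (simp add: sum.reindex h2)
  qed
  have sum3: "sum h S3 = (\<Sum>v\<in>G. smult (w * fc v) (g k))"
  proof -
    have "inj_on (\<lambda>v. insert (Suc m, v) R) G"
      using last by (intro inj_onI) (metis insertE insertI1 prod.inject)
    then show ?thesis unfolding S3_def by (simp add: sum.reindex h3)
  qed
  have sum4: "sum h S4 = (\<Sum>(i, v)\<in>F \<times> G. smult (w * (fr i * fc v)) (g (k - 1)))"
  proof -
    have "inj_on (\<lambda>(i, v). insert (i, Suc m) (insert (Suc m, v) R)) (F \<times> G)"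
    proof (rule inj_onI, clarify)
      fix i v i' v'
      assume iv: "i \<in> F" "v \<in> G" "i' \<in> F" "v' \<in> G"
        and eq: "insert (i, Suc m) (insert (Suc m, v) R) = insert (i', Suc m) (insert (Suc m, v') R)"
      have "(i, Suc m) \<in> insert (i', Suc m) (insert (Suc m, v') R)"
        "(Suc m, v) \<in> insert (i', Suc m) (insert (Suc m, v') R)"
        by (simp_all flip: eq)
      then show "i = i' \<and> v = v'" using iv notM last by auto
    qed
    then show ?thesis unfolding S4_def by (subst sum.reindex) (auto intro!: sum.cong simp: h4)
  qed
  have disj: "{R, insert (Suc m, Suc m) R} \<inter> S2 = {}"
    "({R, insert (Suc m, Suc m) R} \<union> S2) \<inter> S3 = {}"
    "({R, insert (Suc m, Suc m) R} \<union> S2 \<union> S3) \<inter> S4 = {}"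
  proof -
    \<comment> \<open>The classes are told apart by whether the new row, the new column and the
      corner are occupied.\<close>
    define rw where "rw R' \<longleftrightarrow> (\<exists>v. (Suc m, v) \<in> R')" for R' :: "(nat \<times> nat) set"
    define cl where "cl R' \<longleftrightarrow> (\<exists>i. (i, Suc m) \<in> R')" for R' :: "(nat \<times> nat) set"
    define cr where "cr R' \<longleftrightarrow> (Suc m, Suc m) \<in> R'" for R' :: "(nat \<times> nat) set"
    have "\<not> rw R" "\<not> cl R" "cr (insert (Suc m, Suc m) R)"
      using last by (auto simp: rw_def cl_def cr_def)
    moreover have "\<not> rw R'" "cl R'" "\<not> cr R'" if "R' \<in> S2" for R'
      using that last notM by (auto simp: rw_def cl_def cr_def S2_def)
    moreover have "rw R'" "\<not> cl R'" "\<not> cr R'" if "R' \<in> S3" for R'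
      using that last notM by (auto simp: rw_def cl_def cr_def S3_def)
    moreover have "rw R'" "cl R'" "\<not> cr R'" if "R' \<in> S4" for R'
      using that last notM by (auto simp: rw_def cl_def cr_def S4_def)
    ultimately show "{R, insert (Suc m, Suc m) R} \<inter> S2 = {}"
      "({R, insert (Suc m, Suc m) R} \<union> S2) \<inter> S3 = {}"
      "({R, insert (Suc m, Suc m) R} \<union> S2 \<union> S3) \<inter> S4 = {}"
      by blast+
  qed
  have fin: "finite S2" "finite S3" "finite S4"
    using finFG by (auto simp: S2_def S3_def S4_def)
  have "R \<noteq> insert (Suc m, Suc m) R" using last by blast
  then have "sum h ({R, insert (Suc m, Suc m) R} \<union> S2 \<union> S3 \<union> S4) =
      h R + h (insert (Suc m, Suc m) R) + sum h S2 + sum h S3 + sum h S4"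
    using fin disj by (simp add: sum.union_disjoint del: Un_insert_left)
  also have "\<dots> = smult w (g (Suc k) +
      smult ((if k = 0 then p else 1) + sum fr F + sum fc G) (g k) + smult (sum fr F * sum fc G) (g (k - 1)))"
  proof -
    have "sum h S2 = smult w (smult (sum fr F) (g k))"
      unfolding sum2 smult_smult unfolding sum_distrib_left smult_sum_left ..
    moreover have "sum h S3 = smult w (smult (sum fc G) (g k))"
      unfolding sum3 smult_smult unfolding sum_distrib_left smult_sum_left ..
    \<comment> \<open>The free row and the free column are chosen independently, so the sum over
      pairs factors.\<close>
    moreover have "sum h S4 = smult w (smult (sum fr F * sum fc G) (g (k - 1)))"
      unfolding sum4 smult_smult sum_product sum.cartesian_product
      unfolding sum_distrib_left smult_sum_left by (simp add: case_prod_beta')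
    ultimately show ?thesis
      by (simp only: h0 h1 smult_smult [symmetric] smult_add_left smult_add_right add.assoc)
  qed
  also have "\<dots> = smult w
      (g (Suc k) + smult (if k = 0 then p else a + c + 2 * of_nat k - 1) (g k) +
       (if k = 0 then 0 else smult ((a + of_nat k - 1) * (c + of_nat k - 1)) (g (k - 1))))"
  \<comment> \<open>For \<open>k = 0\<close> nothing is free, both sums are empty, and the term at
    the truncated index \<open>k - 1\<close> has coefficient 0. Otherwise the corner weighs 1 and
    both sums come from \<open>sum_least_weight\<close>.\<close>
  proof (cases "k = 0")
    case True
    then have "F = {}" "G = {}" using cardFG finFG by auto
    then show ?thesis using True by simp
  next
    case False
    then have ne: "F \<noteq> {}" "G \<noteq> {}" using cardFG by auto
    have sums: "sum fr F = c + of_nat k - 1" "sum fc G = a + of_nat k - 1"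
      unfolding fr_def fc_def
      using sum_least_weight[OF finFG(1) ne(1)] sum_least_weight[OF finFG(2) ne(2)] cardFG by auto
    have "1 + (c + of_nat k - 1) + (a + of_nat k - 1) = a + c + 2 * of_nat k - 1"
      by (simp add: algebra_simps)
    then show ?thesis
      using False by (simp only: sums if_False mult.commute)
  qed
  finally show ?thesis
    unfolding rook_placement_extensions[OF R] by (simp only: w_def S2_def S3_def S4_def F_def G_def flip: h_def)
qed

section \<open>Powers of \<open>x\<close> and moments as weighted sums over placements\<close>

text \<open>The three-term recurrence solved for \<open>x\<close> times the polynomial; the case
  \<open>k = 0\<close> encodes that the polynomial of index -1 vanishes.\<close>

lemma X_times_orth_poly:
  "pCons 0 (orth_poly b l k) = orth_poly b l (Suc k) + smult (b k) (orth_poly b l k) +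
    (if k = 0 then 0 else smult (l k) (orth_poly b l (k - 1)))"
  by (cases k) (simp_all add: algebra_simps)

text \<open>By induction on the board size: multiplication by \<open>x\<close> spreads each term
  over the extensions of its placement, since \<open>b k\<close> and \<open>l k\<close> are the
  total weights of the extensions keeping and lowering \<open>k\<close>.\<close>

lemma monom_eq_sum_rook_placements:
  fixes a p c :: "'r::comm_ring_1"
  assumes b: "\<And>k. b k = (if k = 0 then p else a + c + 2 * of_nat k - 1)"
    and l: "\<And>k. k \<ge> 1 \<Longrightarrow> l k = (a + of_nat k - 1) * (c + of_nat k - 1)"
  shows "monom 1 m =
    (\<Sum>R\<in>rook_placements m. smult (placement_weight a p c R) (orth_poly b l (m - card R)))"
proof (induction m)
  case 0
  show ?case by (simp add: rook_placements_0 placement_weight_def)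
next
  case (Suc m)
  \<comment> \<open>Placements on the larger board are grouped by their restriction to the old
    board, which is again a placement.\<close>
  have "(\<Sum>R\<in>rook_placements (Suc m). smult (placement_weight a p c R) (orth_poly b l (Suc m - card R))) =
    (\<Sum>R\<in>rook_placements m.
      \<Sum>R' | R' \<in> rook_placements (Suc m) \<and> R' \<inter> {1..m} \<times> {1..m} = R.
        smult (placement_weight a p c R') (orth_poly b l (Suc m - card R')))"
    by (rule sum.group [symmetric])
      (auto simp: finite_rook_placements rook_placements_def intro: inj_on_subset)
  also have "\<dots> = (\<Sum>R\<in>rook_placements m.
      smult (placement_weight a p c R) (pCons 0 (orth_poly b l (m - card R))))"
    by (intro sum.cong refl, subst sum_over_extensions[OF _ refl])
      (auto simp: X_times_orth_poly[of b l] b l simp del: orth_poly.simps)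
  also have "\<dots> = pCons 0 1 * (\<Sum>R\<in>rook_placements m.
      smult (placement_weight a p c R) (orth_poly b l (m - card R)))"
    by (simp add: sum_distrib_left)
  also have "\<dots> = monom 1 (Suc m)"
    unfolding Suc.IH [symmetric] by (simp add: monom_Suc)
  finally show ?case ..
qed

lemma moment_eq_sum_rook_placements:
  fixes a p c :: "'r::comm_ring_1"
  assumes "\<And>k. b k = (if k = 0 then p else a + c + 2 * of_nat k - 1)"
    and "\<And>k. k \<ge> 1 \<Longrightarrow> l k = (a + of_nat k - 1) * (c + of_nat k - 1)"
  shows "moment b l n = (\<Sum>R | R \<in> rook_placements n \<and> card R = n. placement_weight a p c R)"
proof -
  define L where "L = moment_functional b l"
  have L: "is_moment_functional b l L"
    unfolding L_def by (rule is_moment_functional_moment_functional)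
  interpret module_hom smult "(*)" L
    using L by (simp add: is_moment_functional_def)
  have L_orth: "L (orth_poly b l k) = (if k = 0 then 1 else 0)" for k
    using L by (simp add: is_moment_functional_def)
  have "moment b l n = L (\<Sum>R\<in>rook_placements n.
      smult (placement_weight a p c R) (orth_poly b l (n - card R)))"
    unfolding moment_def L_def by (subst monom_eq_sum_rook_placements[OF assms]) auto
  also have "\<dots> = (\<Sum>R\<in>rook_placements n. placement_weight a p c R * (if n - card R = 0 then 1 else 0))"
    by (simp only: sum scale L_orth)
  \<comment> \<open>Truncated subtraction gives only \<open>n \<le> card R\<close>; the bound
    \<open>card R \<le> n\<close> makes it an equality.\<close>
  also have "\<dots> = (\<Sum>R\<in>rook_placements n. if card R = n then placement_weight a p c R else 0)"
    using card_rook_placement_le by (intro sum.cong) fastforce+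
  finally show ?thesis
    by (simp add: sum.inter_filter finite_rook_placements)
qed

section \<open>Full placements as graphs of permutations\<close>

definition perm_graph :: "nat \<Rightarrow> (nat \<Rightarrow> nat) \<Rightarrow> (nat \<times> nat) set" where
  "perm_graph n \<pi> = (\<lambda>i. (i, \<pi> i)) ` {1..n}"

text \<open>With \<open>n\<close> rooks in distinct rows every row is occupied exactly once, so the
  placement is the graph of a map; distinct columns make the map injective, hence bijective on
  \<open>{1..n}\<close>.\<close>

lemma bij_betw_perm_graph:
  "bij_betw (perm_graph n) {\<pi>. \<pi> permutes {1..n}} {R \<in> rook_placements n. card R = n}"
proof (rule bij_betwI')
  fix \<pi> \<sigma> assume *: "\<pi> \<in> {\<pi>. \<pi> permutes {1..n}}" "\<sigma> \<in> {\<pi>. \<pi> permutes {1..n}}"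
  show "perm_graph n \<pi> = perm_graph n \<sigma> \<longleftrightarrow> \<pi> = \<sigma>"
  proof
    assume eq: "perm_graph n \<pi> = perm_graph n \<sigma>"
    show "\<pi> = \<sigma>"
    proof
      fix i
      show "\<pi> i = \<sigma> i"
      proof (cases "i \<in> {1..n}")
        case True
        then have "(i, \<pi> i) \<in> perm_graph n \<pi>" by (simp add: perm_graph_def)
        then have "(i, \<pi> i) \<in> perm_graph n \<sigma>" by (simp only: eq)
        then show ?thesis by (auto simp: perm_graph_def)
      next
        case False
        then show ?thesis using * by (simp add: permutes_not_in)
      qed
    qed
  qed simp
next
  fix \<pi> assume "\<pi> \<in> {\<pi>. \<pi> permutes {1..n}}"
  then have \<pi>: "\<pi> permutes {1..n}" by simp
  have "card (perm_graph n \<pi>) = n"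
    unfolding perm_graph_def by (subst card_image) (auto simp: inj_on_def)
  moreover have "perm_graph n \<pi> \<subseteq> {1..n} \<times> {1..n}"
    using permutes_in_image[OF \<pi>] by (auto simp: perm_graph_def simp del: atLeastAtMost_iff)
  moreover have "inj_on fst (perm_graph n \<pi>)" "inj_on snd (perm_graph n \<pi>)"
    using permutes_inj[OF \<pi>] by (auto simp: perm_graph_def inj_on_def dest: injD)
  ultimately show "perm_graph n \<pi> \<in> {R \<in> rook_placements n. card R = n}"
    by (simp add: rook_placements_def)
next
  fix R assume "R \<in> {R \<in> rook_placements n. card R = n}"
  then have sub: "R \<subseteq> {1..n} \<times> {1..n}" and inj: "inj_on fst R" "inj_on snd R" and card: "card R = n"
    by (auto simp: rook_placements_def)
  have fst_R: "fst ` R = {1..n}"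
    using sub by (intro card_subset_eq) (auto simp: card_image[OF inj(1)] card)
  \<comment> \<open>The column of the unique rook in row \<open>i\<close>; outside the board
    \<open>permutes\<close> demands the identity.\<close>
  define \<pi> where "\<pi> i = (if i \<in> {1..n} then snd (inv_into R fst i) else i)" for i
  have R_iff: "inv_into R fst i \<in> R" "fst (inv_into R fst i) = i" if "i \<in> {1..n}" for i
    using that fst_R by (auto intro: inv_into_into f_inv_into_f)
  have inR: "(i, \<pi> i) \<in> R" if "i \<in> {1..n}" for i
    using R_iff[OF that] that unfolding \<pi>_def by (metis prod.collapse)
  have "perm_graph n \<pi> \<subseteq> R" using inR by (auto simp: perm_graph_def)
  moreover have "card (perm_graph n \<pi>) = n"
    unfolding perm_graph_def by (subst card_image) (auto simp: inj_on_def)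
  moreover have "finite R" using sub by (rule finite_subset) auto
  ultimately have R_eq: "R = perm_graph n \<pi>"
    using card by (metis card_subset_eq)
  have "inj_on \<pi> {1..n}"
    using inj_onD[OF inj(2) _ inR inR] by (auto intro!: inj_onI)
  moreover have "\<pi> ` {1..n} \<subseteq> {1..n}" using inR sub by blast
  ultimately have "bij_betw \<pi> {1..n} {1..n}"
    by (simp add: bij_betw_def endo_inj_surj)
  then have "\<pi> permutes {1..n}"
    by (rule bij_imp_permutes) (auto simp: \<pi>_def)
  then show "\<exists>\<pi>\<in>{\<pi>. \<pi> permutes {1..n}}. R = perm_graph n \<pi>"
    using R_eq by blast
qed

section \<open>Permutation statistics read off the rook weights\<close>

text \<open>Pigeonhole: the first \<open>i\<close> entries are distinct and lie in
  \<open>{1..\<pi> i}\<close>.\<close>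

lemma is_LRmax_le:
  assumes \<pi>: "\<pi> permutes {1..n}" and i: "i \<in> {1..n}" and "is_LRmax n \<pi> i"
  shows "i \<le> \<pi> i"
proof -
  have "\<pi> ` {1..i} \<subseteq> {1..\<pi> i}"
  proof clarify
    fix j assume j: "j \<in> {1..i}"
    then have "\<pi> j \<in> {1..n}" using i by (subst permutes_in_image[OF \<pi>]) auto
    moreover have "\<pi> j \<le> \<pi> i"
      using assms(3) j i by (cases "j = i") (auto simp: is_LRmax_def less_imp_le)
    ultimately show "\<pi> j \<in> {1..\<pi> i}" by simp
  qed
  then have "card {1..i} \<le> card {1..\<pi> i}"
    by (intro card_inj_on_le[of \<pi>]) (auto intro: permutes_inj_on[OF \<pi>])
  then show ?thesis by simp
qed

text \<open>By injectivity this is the contrapositive; it quantifies over smaller values, as the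
  column condition in \<open>cell_weight\<close> does.\<close>

lemma is_RLmin_iff:
  assumes \<pi>: "\<pi> permutes {1..n}" and i: "i \<in> {1..n}"
  shows "is_RLmin n \<pi> i \<longleftrightarrow> (\<forall>j\<in>{1..n}. \<pi> j < \<pi> i \<longrightarrow> j < i)"
  unfolding is_RLmin_def
  by (metis inj_eq[OF permutes_inj[OF \<pi>]] less_asym linorder_less_linear)

text \<open>Pigeonhole from the other end: the entries from position \<open>i\<close> on are
  distinct and lie in \<open>{\<pi> i..n}\<close>.\<close>

lemma is_RLmin_ge:
  assumes \<pi>: "\<pi> permutes {1..n}" and i: "i \<in> {1..n}" and "is_RLmin n \<pi> i"
  shows "\<pi> i \<le> i"
proof -
  have "\<pi> ` {i..n} \<subseteq> {\<pi> i..n}"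
  proof clarify
    fix j assume j: "j \<in> {i..n}"
    then have "\<pi> j \<in> {1..n}" using i by (subst permutes_in_image[OF \<pi>]) auto
    moreover have "\<pi> i \<le> \<pi> j"
      using assms(3) j i by (cases "j = i") (auto simp: is_RLmin_def less_imp_le)
    ultimately show "\<pi> j \<in> {\<pi> i..n}" by simp
  qed
  then have "card {i..n} \<le> card {\<pi> i..n}"
    by (intro card_inj_on_le[of \<pi>]) (auto intro: permutes_inj_on[OF \<pi>])
  then show ?thesis using i by auto
qed

text \<open>At a fixed point that is a left-to-right maximum, \<open>\<pi>\<close> maps
  \<open>{1..<i}\<close> into itself, hence onto it, so all smaller values stand earlier. The
  converse uses \<open>{i<..n}\<close>. Thus on the diagonal the row condition alone detects
  pivots.\<close>

lemma is_RLmin_iff_is_LRmax_fixpoint: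
  assumes \<pi>: "\<pi> permutes {1..n}" and i: "i \<in> {1..n}" and fixp: "\<pi> i = i"
  shows "is_RLmin n \<pi> i \<longleftrightarrow> is_LRmax n \<pi> i"
proof
  assume LR: "is_LRmax n \<pi> i"
  have "\<pi> ` {1..<i} \<subseteq> {1..<i}"
  proof clarify
    fix j assume "j \<in> {1..<i}"
    then show "\<pi> j \<in> {1..<i}"
      using LR i fixp permutes_in_image[OF \<pi>, of j] by (auto simp: is_LRmax_def)
  qed
  then have eq: "\<pi> ` {1..<i} = {1..<i}"
    by (intro endo_inj_surj) (auto intro: permutes_inj_on[OF \<pi>])
  have "j < i" if "j \<in> {1..n}" "\<pi> j < \<pi> i" for j
  proof -
    have "\<pi> j \<in> \<pi> ` {1..<i}"
      unfolding eq using that fixp permutes_in_image[OF \<pi>, of j] by auto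
    then show ?thesis by (simp add: inj_image_mem_iff[OF permutes_inj[OF \<pi>]])
  qed
  then show "is_RLmin n \<pi> i" by (simp add: is_RLmin_iff[OF \<pi> i])
next
  assume RL: "is_RLmin n \<pi> i"
  have "\<pi> ` {i<..n} \<subseteq> {i<..n}"
  proof clarify
    fix j assume "j \<in> {i<..n}"
    then show "\<pi> j \<in> {i<..n}"
      using RL i fixp permutes_in_image[OF \<pi>, of j] by (auto simp: is_RLmin_def)
  qed
  then have eq: "\<pi> ` {i<..n} = {i<..n}"
    by (intro endo_inj_surj) (auto intro: permutes_inj_on[OF \<pi>])
  have "\<pi> j < \<pi> i" if "j \<in> {1..n}" "j < i" for j
  proof (rule ccontr)
    assume "\<not> \<pi> j < \<pi> i"
    moreover have "\<pi> j \<noteq> \<pi> i"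
      using that inj_eq[OF permutes_inj[OF \<pi>], of j i] by simp
    ultimately have "\<pi> j \<in> \<pi> ` {i<..n}"
      unfolding eq using that fixp permutes_in_image[OF \<pi>, of j] by auto
    then show False using that by (simp add: inj_image_mem_iff[OF permutes_inj[OF \<pi>]])
  qed
  then show "is_LRmax n \<pi> i" by (simp add: is_LRmax_def)
qed

text \<open>If \<open>i < \<pi> i\<close> a right-to-left minimum is impossible, if
  \<open>\<pi> i < i\<close> a left-to-right maximum is, and on the diagonal the two coincide. At
  most one of the three conditions holds; the product form lets the total weight split into three
  powers.\<close>

lemma cell_weight_perm_graph:
  assumes \<pi>: "\<pi> permutes {1..n}" and i: "i \<in> {1..n}"
  shows "cell_weight a p c (perm_graph n \<pi>) (i, \<pi> i) =
    (if is_RLmin n \<pi> i \<and> \<not> is_LRmax n \<pi> i then a else 1) *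
    (if is_LRmax n \<pi> i \<and> is_RLmin n \<pi> i then p else 1) *
    (if is_LRmax n \<pi> i \<and> \<not> is_RLmin n \<pi> i then c else 1)"
proof -
  have LR: "(\<forall>j\<in>{1..<i}. \<exists>u<\<pi> i. (j, u) \<in> perm_graph n \<pi>) \<longleftrightarrow> is_LRmax n \<pi> i"
    using i unfolding perm_graph_def is_LRmax_def by (auto simp: image_iff)
  have "(\<forall>u\<in>{1..<\<pi> i}. \<exists>j<i. (j, u) \<in> perm_graph n \<pi>) \<longleftrightarrow> (\<forall>j\<in>{1..n}. \<pi> j < \<pi> i \<longrightarrow> j < i)"
    (is "?l \<longleftrightarrow> ?r")
  proof
    assume l: ?l
    show ?r
    proof (intro ballI impI)
      fix j assume j: "j \<in> {1..n}" "\<pi> j < \<pi> i"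
      then have "\<pi> j \<in> {1..<\<pi> i}" using permutes_in_image[OF \<pi>, of j] by auto
      then obtain j' where "j' < i" "(j', \<pi> j) \<in> perm_graph n \<pi>" using l by blast
      then show "j < i" using permutes_inj[OF \<pi>] by (auto simp: perm_graph_def dest: injD)
    qed
  next
    assume r: ?r
    show ?l
    proof
      fix u assume u: "u \<in> {1..<\<pi> i}"
      have "\<pi> i \<in> {1..n}" using i permutes_in_image[OF \<pi>] by blast
      then have "u \<in> \<pi> ` {1..n}" using u by (subst permutes_image[OF \<pi>]) auto
      then obtain j where "j \<in> {1..n}" "u = \<pi> j" by blast
      then show "\<exists>j<i. (j, u) \<in> perm_graph n \<pi>"
        using r u by (intro exI[of _ j]) (auto simp: perm_graph_def)
    qed
  qed
  then have RL: "(\<forall>u\<in>{1..<\<pi> i}. \<exists>j<i. (j, u) \<in> perm_graph n \<pi>) \<longleftrightarrow> is_RLmin n \<pi> i"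
    by (simp add: is_RLmin_iff[OF \<pi> i])
  show ?thesis
    unfolding cell_weight_def prod.case LR RL
    using is_LRmax_le[OF \<pi> i] is_RLmin_ge[OF \<pi> i] is_RLmin_iff_is_LRmax_fixpoint[OF \<pi> i]
    by (cases "i < \<pi> i"; cases "\<pi> i < i") auto
qed

lemma placement_weight_perm_graph:
  assumes \<pi>: "\<pi> permutes {1..n}"
  shows "placement_weight a p c (perm_graph n \<pi>) =
    a ^ (RLmin n \<pi> - pivot n \<pi>) * p ^ pivot n \<pi> * c ^ (LRmax n \<pi> - pivot n \<pi>)"
proof -
  let ?LR = "is_LRmax n \<pi>" and ?RL = "is_RLmin n \<pi>"
  have pw: "(\<Prod>i\<in>{1..n}. if P i then x else 1) = x ^ card {i \<in> {1..n}. P i}" for P and x :: 'a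
    by (simp add: prod.inter_filter [symmetric])
  have piv: "pivot n \<pi> = card {i \<in> {1..n}. ?LR i \<and> ?RL i}"
    by (simp add: pivot_def)
  \<comment> \<open>Pivots form a subset of the right-to-left minima, so the truncated difference is
    the size of the set difference.\<close>
  have rl: "RLmin n \<pi> - pivot n \<pi> = card {i \<in> {1..n}. ?RL i \<and> \<not> ?LR i}"
    unfolding RLmin_def piv by (subst card_Diff_subset [symmetric]) (auto intro: arg_cong[where f = card])
  have lr: "LRmax n \<pi> - pivot n \<pi> = card {i \<in> {1..n}. ?LR i \<and> \<not> ?RL i}"
    unfolding LRmax_def piv by (subst card_Diff_subset [symmetric]) (auto intro: arg_cong[where f = card])
  have "placement_weight a p c (perm_graph n \<pi>) =
      (\<Prod>i\<in>{1..n}. cell_weight a p c (perm_graph n \<pi>) (i, \<pi> i))"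
    unfolding placement_weight_def by (subst (2) perm_graph_def, subst prod.reindex) (auto simp: inj_on_def)
  also have "\<dots> = (\<Prod>i\<in>{1..n}. (if ?RL i \<and> \<not> ?LR i then a else 1) *
      (if ?LR i \<and> ?RL i then p else 1) * (if ?LR i \<and> \<not> ?RL i then c else 1))"
    by (intro prod.cong refl cell_weight_perm_graph[OF \<pi>])
  finally show ?thesis
    unfolding rl lr unfolding piv by (simp only: prod.distrib pw)
qed

theorem theorem3p4:
  fixes X Y :: "'a::comm_ring_1 poly poly" and n :: nat
  assumes "X = [:[:0, 1:]:]" and "Y = [:0, 1:]"
  shows "moment (\<lambda>k. 2 * of_nat k + X + Y) (\<lambda>k. (of_nat k + X) * (of_nat k - 1 + Y)) n =
    (\<Sum>\<pi> | \<pi> permutes {1..n}.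
       (X + 1) ^ (RLmin n \<pi> - pivot n \<pi>) * (X + Y) ^ pivot n \<pi> * Y ^ (LRmax n \<pi> - pivot n \<pi>))"
proof -
  \<comment> \<open>Here \<open>a = X + 1\<close>, \<open>p = X + Y\<close>, \<open>c = Y\<close>.
    Since \<open>p = a + c - 1\<close>, the case \<open>k = 0\<close> of \<open>b\<close> agrees
    with the general formula.\<close>
  have "moment (\<lambda>k. 2 * of_nat k + X + Y) (\<lambda>k. (of_nat k + X) * (of_nat k - 1 + Y)) n =
      (\<Sum>R | R \<in> rook_placements n \<and> card R = n. placement_weight (X + 1) (X + Y) Y R)"
    by (rule moment_eq_sum_rook_placements) (simp_all add: algebra_simps)
  also have "\<dots> = (\<Sum>\<pi> | \<pi> permutes {1..n}. placement_weight (X + 1) (X + Y) Y (perm_graph n \<pi>))"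
    by (rule sum.reindex_bij_betw [OF bij_betw_perm_graph, symmetric])
  finally show ?thesis
    by (simp add: placement_weight_perm_graph)
qed

end
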